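(* Let $X$ be a Tychonoff space and let $\mathscr{P}$ be an ideal of closed sets in $X$ with $|X_\mathscr{P}|\geq 3$. In $AG(C_\mathscr{P}(X))$: (i) Any edge $f-g$ is an edge of a square (a cycle of length $4$), and so $3\leq c(f,g)\leq 4$. Furthermore, for any distinct $f,g\in Z(C_\mathscr{P}(X))^*$: (a) if $f,g$ are adjacent in $AG(C_\mathscr{P}(X))$ and $fg\neq 0$, then $c(f,g)=3$; (b) if $f,g$ are adjacent in $AG(C_\mathscr{P}(X))$ and $fg=0$, then $c(f,g)=3$ if $|int_XZ(f)\cap X_\mathscr{P}|\geq 2$ and $|int_XZ(g)\cap X_\mathscr{P}|\geq 2$, while $c(f,g)=4$ if $|int_XZ(f)\cap X_\mathscr{P}|=1$ or $|int_XZ(g)\cap X_\mathscr{P}|=1$; (c) if $f,g$ are non-adjacent in $AG(C_\mathscr{P}(X))$, then $c(f,g)=4$. (ii) The girth satisfies $gr(AG(C_\mathscr{P}(X)))=3$.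
   Context: $C(X)$ is the ring of all real valued continuous functions on the Tychonoff (completely regular Hausdorff) space $X$; $Z(f)=\{x\in X: f(x)=0\}$. An ideal of closed sets in $X$ is a nonempty family $\mathscr{P}$ of closed subsets of $X$ such that $A,B\in\mathscr{P}$ implies $A\cup B\in\mathscr{P}$, and $A\in\mathscr{P}$, $C\subset A$ with $C$ closed in $X$ implies $C\in\mathscr{P}$. $C_\mathscr{P}(X)=\{f\in C(X): cl_X(X\setminus Z(f))\in\mathscr{P}\}$, a commutative ring (possibly without identity). $X_\mathscr{P}$ is the set of all $x\in X$ having an open neighborhood $V$ with $cl_XV\in\mathscr{P}$. For a commutative ring $R$, $Z(R)^*$ is the set of nonzero zero divisors, i.e. nonzero $a\in R$ with $ab=0$ for some nonzero $b\in R$, and $ann(a)=\{r\in R: ra=0\}$. The annihilator graph $AG(R)$ is the simple graph with vertex set $Z(R)^*$ in which distinct $a,b$ are adjacent iff $ann(a)\cup ann(b)\neq ann(ab)$. For distinct vertices $f,g$, $c(f,g)$ denotes the smallest length of a cycle in $AG(C_\mathscr{P}(X))$ containing both $f$ and $g$ as vertices. The girth $gr(H)$ of a graph $H$ is the length of its smallest cycle. *)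

theory Defs
  imports "HOL-Analysis.Analysis" "HOL-Library.Function_Algebras"
begin

section \<open>Simple graphs, cycles, girth\<close>

record 'v sgraph =
  verts :: "'v set"
  adj :: "'v \<Rightarrow> 'v \<Rightarrow> bool"

text \<open>A cycle is listed by its vertices, without repeating the first one at the end; the list is
  read cyclically, so its length is the length of the cycle.\<close>

definition is_cycle :: "'v sgraph \<Rightarrow> 'v list \<Rightarrow> bool" where
  "is_cycle G p \<longleftrightarrow>
     3 \<le> length p \<and> distinct p \<and> set p \<subseteq> verts G \<and>
     (\<forall>i < length p. adj G (p ! i) (p ! (Suc i mod length p)))"

definition cycle_edges :: "'v list \<Rightarrow> 'v set set" where
  "cycle_edges p = {{p ! i, p ! (Suc i mod length p)} | i. i < length p}"

text \<open>Both minima are taken in \<^typ>\<open>enat\<close>, so that they are \<open>\<infinity>\<close> when there is no such cycle.\<close>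

definition min_cycle_length :: "'v sgraph \<Rightarrow> 'v \<Rightarrow> 'v \<Rightarrow> enat" where
  "min_cycle_length G u v =
     Inf {enat (length p) | p. is_cycle G p \<and> u \<in> set p \<and> v \<in> set p}"

definition girth :: "'v sgraph \<Rightarrow> enat" where
  "girth G = Inf {enat (length p) | p. is_cycle G p}"


section \<open>The annihilator graph of a commutative ring\<close>

text \<open>A commutative ring, possibly without identity, is given as a subring \<open>R\<close> of a type of class
  \<^class>\<open>comm_ring\<close> (which does not require an identity either).\<close>

definition nonzero_zero_divisors :: "'r::comm_ring set \<Rightarrow> 'r set" where
  "nonzero_zero_divisors R = {a \<in> R. a \<noteq> 0 \<and> (\<exists>b \<in> R. b \<noteq> 0 \<and> a * b = 0)}"

definition annihilator :: "'r::comm_ring set \<Rightarrow> 'r \<Rightarrow> 'r set" where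
  "annihilator R a = {r \<in> R. r * a = 0}"

definition annihilator_graph :: "'r::comm_ring set \<Rightarrow> 'r sgraph" where
  "annihilator_graph R =
     \<lparr> verts = nonzero_zero_divisors R,
       adj = (\<lambda>a b. a \<in> nonzero_zero_divisors R \<and> b \<in> nonzero_zero_divisors R \<and> a \<noteq> b \<and>
                    annihilator R a \<union> annihilator R b \<noteq> annihilator R (a * b)) \<rparr>"


section \<open>Ideals of closed sets and the ring they determine\<close>

definition tychonoff_space :: "'a topology \<Rightarrow> bool" where
  "tychonoff_space X \<longleftrightarrow> completely_regular_space X \<and> Hausdorff_space X"

definition ideal_of_closed_sets :: "'a topology \<Rightarrow> 'a set set \<Rightarrow> bool" where
  "ideal_of_closed_sets X P \<longleftrightarrow>
     P \<noteq> {} \<and> (\<forall>A \<in> P. closedin X A) \<and>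
     (\<forall>A \<in> P. \<forall>B \<in> P. A \<union> B \<in> P) \<and>
     (\<forall>A \<in> P. \<forall>C. closedin X C \<and> C \<subseteq> A \<longrightarrow> C \<in> P)"

text \<open>A function on the space \<open>X\<close> is represented by its extension by \<open>0\<close> to the whole
  type. Thus equality of representatives is equality on \<^term>\<open>topspace X\<close>, and the
  pointwise operations of \<^theory>\<open>HOL-Library.Function_Algebras\<close> are the ring operations.\<close>

definition cont_ring :: "'a topology \<Rightarrow> ('a \<Rightarrow> real) set" where
  "cont_ring X = {f. continuous_map X euclideanreal f \<and> (\<forall>x. x \<notin> topspace X \<longrightarrow> f x = 0)}"

definition zero_set :: "'a topology \<Rightarrow> ('a \<Rightarrow> real) \<Rightarrow> 'a set" where
  "zero_set X f = {x \<in> topspace X. f x = 0}"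

definition ideal_cont_ring :: "'a topology \<Rightarrow> 'a set set \<Rightarrow> ('a \<Rightarrow> real) set" where
  "ideal_cont_ring X P = {f \<in> cont_ring X. X closure_of (topspace X - zero_set X f) \<in> P}"

definition ideal_points :: "'a topology \<Rightarrow> 'a set set \<Rightarrow> 'a set" where
  "ideal_points X P = {x. \<exists>V. openin X V \<and> x \<in> V \<and> X closure_of V \<in> P}"

lemma ideal_cont_ring_subring:
  assumes "ideal_of_closed_sets X P"
  shows "0 \<in> ideal_cont_ring X P"
    and "f \<in> ideal_cont_ring X P \<Longrightarrow> - f \<in> ideal_cont_ring X P"
    and "\<lbrakk>f \<in> ideal_cont_ring X P; g \<in> ideal_cont_ring X P\<rbrakk> \<Longrightarrow> f + g \<in> ideal_cont_ring X P"
    and "\<lbrakk>f \<in> ideal_cont_ring X P; g \<in> ideal_cont_ring X P\<rbrakk> \<Longrightarrow> f * g \<in> ideal_cont_ring X P"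
proof -
  let ?s = "\<lambda>f. X closure_of (topspace X - zero_set X f)"
  obtain A where "A \<in> P"
    using assms unfolding ideal_of_closed_sets_def by blast
  have sub: "C \<in> P" if "A \<in> P" "closedin X C" "C \<subseteq> A" for A C
    using assms that unfolding ideal_of_closed_sets_def by blast
  have un: "A \<union> B \<in> P" if "A \<in> P" "B \<in> P" for A B
    using assms that unfolding ideal_of_closed_sets_def by blast
  have ring_iff: "h \<in> ideal_cont_ring X P \<longleftrightarrow>
      continuous_map X euclideanreal h \<and> (\<forall>x. x \<notin> topspace X \<longrightarrow> h x = 0) \<and> ?s h \<in> P" for h
    by (simp add: ideal_cont_ring_def cont_ring_def)
  have "?s 0 = {}"
    by (simp add: zero_set_def)
  moreover have "{} \<in> P"
    using sub[OF \<open>A \<in> P\<close>, of "{}"] by simp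
  ultimately show "0 \<in> ideal_cont_ring X P"
    by (simp add: ring_iff zero_fun_def)
  show "- f \<in> ideal_cont_ring X P" if "f \<in> ideal_cont_ring X P"
  proof -
    have "?s (- f) = ?s f"
      by (simp add: zero_set_def)
    moreover have "continuous_map X euclideanreal (- f)"
      unfolding fun_Compl_def using that by (intro continuous_map_minus) (simp add: ring_iff)
    ultimately show ?thesis
      using that by (simp add: ring_iff)
  qed
  show "f + g \<in> ideal_cont_ring X P"
    if fg: "f \<in> ideal_cont_ring X P" "g \<in> ideal_cont_ring X P"
  proof -
    have "?s (f + g) \<subseteq> ?s f \<union> ?s g"
      unfolding closure_of_Un[symmetric]
      by (rule closure_of_mono) (auto simp: zero_set_def)
    then have "?s (f + g) \<in> P"
      using sub[OF un closedin_closure_of] fg ring_iff by blast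
    moreover have "continuous_map X euclideanreal (f + g)"
      unfolding plus_fun_def using fg by (intro continuous_map_add) (simp_all add: ring_iff)
    ultimately show ?thesis
      using fg by (simp add: ring_iff)
  qed
  show "f * g \<in> ideal_cont_ring X P"
    if fg: "f \<in> ideal_cont_ring X P" "g \<in> ideal_cont_ring X P"
  proof -
    have "?s (f * g) \<subseteq> ?s f"
      by (rule closure_of_mono) (auto simp: zero_set_def)
    then have "?s (f * g) \<in> P"
      using sub[OF _ closedin_closure_of] fg ring_iff by blast
    moreover have "continuous_map X euclideanreal (f * g)"
      unfolding times_fun_def using fg by (intro continuous_map_real_mult) (simp_all add: ring_iff)
    ultimately show ?thesis
      using fg by (simp add: ring_iff)
  qed
qed


section \<open>Lower bounds on possibly infinite cardinalities\<close>

text \<open>\<^const>\<open>card\<close> is \<open>0\<close> on infinite sets, so these must be admitted separately.\<close>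

definition card_at_least :: "'a set \<Rightarrow> nat \<Rightarrow> bool" where
  "card_at_least S n \<longleftrightarrow> infinite S \<or> n \<le> card S"

end

theory Submission
  imports Defs
begin

text \<open>
  The ring \<open>R = C\<^sub>P(X)\<close> has no nonzero nilpotents, and in such a ring the annihilator graph is
  governed by inclusion of annihilators: \<open>a\<close> and \<open>b\<close> are adjacent exactly when \<open>ann a\<close> and \<open>ann b\<close>
  are incomparable (\<open>adj_iff\<close>). Two nonzero elements with product \<open>0\<close> are therefore always
  adjacent, and a nonzero \<open>s\<close> can, in the absence of \<open>2\<close>-torsion, be doubled
  to \<open>s + s \<noteq> s\<close> with the same annihilator whenever a second vertex of the same kind is wanted. This settles the statements about edges,
  squares and non-adjacent vertices by pure algebra, in any reduced ring without
  \<open>2\<close>-torsion.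

  \<^item> If \<open>f - g\<close> is an edge, choose \<open>s \<in> ann g - ann f\<close> and \<open>t \<in> ann f - ann g\<close>. After replacing
    \<open>s, t\<close> by \<open>sf, tg\<close> one has \<open>st = 0\<close>, and \<open>f - g - s - t\<close> is a square,
    once \<open>s\<close> is doubled if \<open>s = f\<close> and \<open>t\<close> if \<open>t = g\<close> (\<open>square_through_edge\<close>).
    When \<open>fg \<noteq> 0\<close>, the sum \<open>s + t\<close> is adjacent to both \<open>f\<close> and \<open>g\<close>
    (\<open>triangle_if_product_nonzero\<close>).
  \<^item> If \<open>f, g\<close> are not adjacent, then one annihilator contains the other, so a nonzero \<open>s\<close> kills
    both, and \<open>f - s - g - (s + s)\<close> is a square (\<open>square_if_not_adjacent\<close>).
  \<^item> If \<open>fg = 0\<close>, whether the edge lies on a triangle depends on whether each of \<open>ann f\<close> and \<open>ann g\<close>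
    contains two nonzero elements with product \<open>0\<close>, that is, whether the annihilator can be split
    (\<open>triangle_if_product_zero\<close>, \<open>no_triangle_if_not_splits\<close>).

  Topology enters in two places only. Bump functions show that every nonempty open subset of
  \<open>X\<^sub>P\<close> carries a nonzero member of \<open>R\<close> (\<open>bump_function\<close>). Hence \<open>ann f\<close> splits exactly when the open
  set \<open>int Z(f) \<inter> X\<^sub>P\<close>, the largest part of \<open>X\<^sub>P\<close> on which members of \<open>ann f\<close> can live, has two
  points (\<open>annihilator_splits_iff\<close>), and three points of \<open>X\<^sub>P\<close> give three mutually
  annihilating functions, a triangle (\<open>three_orthogonal_functions\<close>).
\<close>

section \<open>Short cycles in annihilator graphs\<close>

lemma adj_annihilator_graph_sym:
  "adj (annihilator_graph R) a b \<Longrightarrow> adj (annihilator_graph R) b a"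
  by (auto simp: annihilator_graph_def mult.commute)

lemma adj_annihilator_graphD:
  assumes "adj (annihilator_graph R) a b"
  shows "a \<noteq> b" "a \<in> verts (annihilator_graph R)" "b \<in> verts (annihilator_graph R)"
  using assms by (auto simp: annihilator_graph_def)

lemma is_cycle_3_iff:
  "is_cycle (annihilator_graph R) [a, b, c] \<longleftrightarrow>
     adj (annihilator_graph R) a b \<and> adj (annihilator_graph R) b c \<and> adj (annihilator_graph R) c a"
    (is "_ \<longleftrightarrow> ?E")
proof -
  have "is_cycle (annihilator_graph R) [a, b, c] \<longleftrightarrow>
      distinct [a, b, c] \<and> {a, b, c} \<subseteq> verts (annihilator_graph R) \<and> ?E"
    by (simp add: is_cycle_def All_less_Suc conj_ac)
  moreover have "distinct [a, b, c] \<and> {a, b, c} \<subseteq> verts (annihilator_graph R)" if E: ?E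
    using adj_annihilator_graphD[of R a b] adj_annihilator_graphD[of R b c]
      adj_annihilator_graphD[of R c a] E by simp
  ultimately show ?thesis by blast
qed

lemma is_cycle_4_iff:
  "is_cycle (annihilator_graph R) [a, b, c, d] \<longleftrightarrow>
     adj (annihilator_graph R) a b \<and> adj (annihilator_graph R) b c \<and>
     adj (annihilator_graph R) c d \<and> adj (annihilator_graph R) d a \<and> a \<noteq> c \<and> b \<noteq> d"
    (is "_ \<longleftrightarrow> ?E")
proof -
  have "is_cycle (annihilator_graph R) [a, b, c, d] \<longleftrightarrow>
      distinct [a, b, c, d] \<and> {a, b, c, d} \<subseteq> verts (annihilator_graph R) \<and> ?E"
    by (auto simp: is_cycle_def All_less_Suc)
  moreover have "distinct [a, b, c, d] \<and> {a, b, c, d} \<subseteq> verts (annihilator_graph R)" if E: ?E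
    using adj_annihilator_graphD[of R a b] adj_annihilator_graphD[of R b c]
      adj_annihilator_graphD[of R c d] adj_annihilator_graphD[of R d a] E by simp
  ultimately show ?thesis by blast
qed

lemma min_cycle_length_le:
  "is_cycle G p \<Longrightarrow> u \<in> set p \<Longrightarrow> v \<in> set p \<Longrightarrow> min_cycle_length G u v \<le> enat (length p)"
  unfolding min_cycle_length_def by (rule Inf_lower) blast

lemma min_cycle_length_ge_3: "3 \<le> min_cycle_length G u v"
  unfolding min_cycle_length_def
  by (rule Inf_greatest) (auto simp: is_cycle_def numeral_eq_enat)

lemma girth_ge_3: "3 \<le> girth G"
  unfolding girth_def by (rule Inf_greatest) (auto simp: is_cycle_def numeral_eq_enat)

lemma min_cycle_length_eq_3:
  assumes "adj (annihilator_graph R) u v" "adj (annihilator_graph R) v w"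
    "adj (annihilator_graph R) w u"
  shows "min_cycle_length (annihilator_graph R) u v = 3"
proof (rule antisym)
  have "is_cycle (annihilator_graph R) [u, v, w]"
    using assms by (simp add: is_cycle_3_iff)
  from min_cycle_length_le[OF this, of u v]
  show "min_cycle_length (annihilator_graph R) u v \<le> 3"
    by (simp add: numeral_eq_enat eval_nat_numeral)
qed (rule min_cycle_length_ge_3)

lemma min_cycle_length_le_4:
  assumes "is_cycle (annihilator_graph R) [a, b, c, d]" "u \<in> {a, b, c, d}" "v \<in> {a, b, c, d}"
  shows "min_cycle_length (annihilator_graph R) u v \<le> 4"
  using min_cycle_length_le[OF assms(1), of u v] assms(2,3)
  by (simp add: numeral_eq_enat eval_nat_numeral)

lemma min_cycle_length_ge_4:
  assumes "u \<noteq> v"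
    and no_triangle: "\<And>w. \<not> (adj (annihilator_graph R) u v \<and> adj (annihilator_graph R) v w \<and>
                         adj (annihilator_graph R) w u)"
  shows "4 \<le> min_cycle_length (annihilator_graph R) u v"
  unfolding min_cycle_length_def
proof (rule Inf_greatest)
  fix n assume "n \<in> {enat (length p) | p. is_cycle (annihilator_graph R) p \<and> u \<in> set p \<and> v \<in> set p}"
  then obtain p where n: "n = enat (length p)" and p: "is_cycle (annihilator_graph R) p"
    and uv: "u \<in> set p" "v \<in> set p" by blast
  have "length p \<noteq> 3"
  proof
    assume "length p = 3"
    then obtain a b c where "p = [a, b, c]"
      by (auto simp: numeral_3_eq_3 length_Suc_conv)
    with p uv \<open>u \<noteq> v\<close> no_triangle show False
      by (auto simp: is_cycle_3_iff dest: adj_annihilator_graph_sym)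
  qed
  moreover have "3 \<le> length p"
    using p by (simp add: is_cycle_def)
  ultimately show "4 \<le> n"
    by (simp add: n numeral_eq_enat)
qed


section \<open>Annihilator graphs of reduced rings\<close>

locale reduced_subring =
  fixes R :: "'r::comm_ring set"
  assumes add_closed: "a \<in> R \<Longrightarrow> b \<in> R \<Longrightarrow> a + b \<in> R"
    and mult_closed: "a \<in> R \<Longrightarrow> b \<in> R \<Longrightarrow> a * b \<in> R"
    and reduced: "a \<in> R \<Longrightarrow> a * a = 0 \<Longrightarrow> a = 0"
    and no_2_torsion: "a \<in> R \<Longrightarrow> a + a = 0 \<Longrightarrow> a = 0"
begin

lemma square_nonzero: "a \<in> R \<Longrightarrow> a \<noteq> 0 \<Longrightarrow> a * a \<noteq> 0"
  using reduced by blast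

lemma mult_square_nonzero:
  assumes "a \<in> R" "b \<in> R" "a * b \<noteq> 0"
  shows "a * (b * b) \<noteq> 0"
proof
  assume "a * (b * b) = 0"
  then have "a * (a * (b * b)) = 0"
    by simp
  then have "(a * b) * (a * b) = 0"
    by (simp add: mult_ac)
  with assms reduced mult_closed show False by blast
qed

text \<open>A witness \<open>r\<close> of adjacency, with \<open>rab = 0\<close> but \<open>ra, rb \<noteq> 0\<close>, yields \<open>ra \<in> ann b - ann a\<close> since
  \<open>ra\<^sup>2 \<noteq> 0\<close>. Conversely, witnesses \<open>s, t\<close> of the two non-inclusions combine to \<open>s + t\<close>.\<close>

lemma adj_iff:
  "adj (annihilator_graph R) a b \<longleftrightarrow>
     a \<in> nonzero_zero_divisors R \<and> b \<in> nonzero_zero_divisors R \<and>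
     (\<exists>s\<in>R. s * b = 0 \<and> s * a \<noteq> 0) \<and> (\<exists>t\<in>R. t * a = 0 \<and> t * b \<noteq> 0)"
  (is "?L \<longleftrightarrow> ?Za \<and> ?Zb \<and> ?S \<and> ?T")
proof
  assume L: ?L
  then have Z: ?Za ?Zb and R: "a \<in> R" "b \<in> R"
    by (auto simp: annihilator_graph_def nonzero_zero_divisors_def)
  have "annihilator R a \<union> annihilator R b \<subseteq> annihilator R (a * b)"
  proof
    fix r assume "r \<in> annihilator R a \<union> annihilator R b"
    moreover have "r * (a * b) = (r * a) * b" "r * (a * b) = (r * b) * a"
      by (simp_all add: mult_ac)
    ultimately show "r \<in> annihilator R (a * b)"
      by (auto simp: annihilator_def)
  qed
  then obtain r where r: "r \<in> R" "r * (a * b) = 0" "r * a \<noteq> 0" "r * b \<noteq> 0"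
    using L by (auto simp: annihilator_graph_def annihilator_def)
  have "(r * a) * b = 0" "(r * b) * a = 0"
    using r(2) by (simp_all add: mult_ac)
  moreover have "(r * a) * a \<noteq> 0" "(r * b) * b \<noteq> 0"
    using mult_square_nonzero r R by (simp_all add: mult.assoc)
  ultimately show "?Za \<and> ?Zb \<and> ?S \<and> ?T"
    using Z r(1) R mult_closed by blast
next
  assume H: "?Za \<and> ?Zb \<and> ?S \<and> ?T"
  then obtain s t where s: "s \<in> R" "s * b = 0" "s * a \<noteq> 0" and t: "t \<in> R" "t * a = 0" "t * b \<noteq> 0"
    by blast
  have "(s + t) * (a * b) = (s * b) * a + (t * a) * b"
    by (simp add: algebra_simps)
  then have "s + t \<in> annihilator R (a * b)"
    using s t add_closed by (simp add: annihilator_def)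
  moreover have "s + t \<notin> annihilator R a \<union> annihilator R b"
    using s t by (simp add: annihilator_def distrib_right)
  ultimately show ?L
    using H s t by (auto simp: annihilator_graph_def)
qed

lemma adjI:
  assumes "a \<in> nonzero_zero_divisors R" "b \<in> nonzero_zero_divisors R"
    and "s \<in> R" "s * b = 0" "s * a \<noteq> 0" and "t \<in> R" "t * a = 0" "t * b \<noteq> 0"
  shows "adj (annihilator_graph R) a b"
  using assms unfolding adj_iff by blast

lemma adj_if_product_zero:
  assumes "a \<in> R" "b \<in> R" "a \<noteq> 0" "b \<noteq> 0" "a * b = 0"
  shows "adj (annihilator_graph R) a b"
proof -
  have "b * a = 0"
    using assms(5) by (simp add: mult.commute)
  moreover from this have "a \<in> nonzero_zero_divisors R" "b \<in> nonzero_zero_divisors R"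
    using assms unfolding nonzero_zero_divisors_def by blast+
  moreover have "a * a \<noteq> 0" "b * b \<noteq> 0"
    using assms square_nonzero by blast+
  ultimately show ?thesis
    using assms adjI[of a b a b] by blast
qed

text \<open>The two annihilating witnesses of an edge can be taken orthogonal to each other.\<close>

lemma orthogonal_witnesses:
  assumes "adj (annihilator_graph R) f g"
  obtains s t where "s \<in> R" "t \<in> R" "s * g = 0" "t * f = 0" "s * f \<noteq> 0" "t * g \<noteq> 0" "s * t = 0"
proof -
  have R: "f \<in> R" "g \<in> R"
    using assms by (auto simp: adj_iff nonzero_zero_divisors_def)
  obtain s t where s: "s \<in> R" "s * g = 0" "s * f \<noteq> 0" and t: "t \<in> R" "t * f = 0" "t * g \<noteq> 0"
    using assms unfolding adj_iff by blast
  have "(s * f) * g = (s * g) * f" "(t * g) * f = (t * f) * g"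
    "(s * f) * (t * g) = (s * g) * (t * f)"
    by (simp_all add: mult_ac)
  then have "(s * f) * g = 0" "(t * g) * f = 0" "(s * f) * (t * g) = 0"
    using s t by simp_all
  moreover have "(s * f) * f \<noteq> 0" "(t * g) * g \<noteq> 0"
    using mult_square_nonzero s t R by (simp_all add: mult.assoc)
  ultimately show ?thesis
    using that[of "s * f" "t * g"] s t R mult_closed by blast
qed

text \<open>Doubling provides a second element with the same annihilator. In the reduced ring
  \<open>(\<int>/2)\<^sup>2\<close>, where doubling fails, the single edge of the annihilator graph lies on no cycle.\<close>

lemma associate_avoiding:
  assumes "s \<in> R" "s \<noteq> 0"
  obtains s' where "s' \<in> R" "s' \<noteq> f" "s' \<noteq> 0" "\<And>b. b \<in> R \<Longrightarrow> s' * b = 0 \<longleftrightarrow> s * b = 0"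
proof (cases "s = f")
  case True
  have "(s + s) * b = 0 \<longleftrightarrow> s * b = 0" if "b \<in> R" for b
    using no_2_torsion[of "s * b"] assms(1) that mult_closed by (auto simp: distrib_right)
  moreover have "s + s \<noteq> 0"
    using assms no_2_torsion by blast
  ultimately show ?thesis
    using that[of "s + s"] assms add_closed True by auto
next
  case False
  then show ?thesis
    using that[of s] assms by blast
qed

text \<open>Orthogonal witnesses \<open>s, t\<close> close the square, except that \<open>s\<close> might be \<open>f\<close> itself, or \<open>t\<close>
  might be \<open>g\<close>.\<close>

lemma square_through_edge:
  assumes fg: "adj (annihilator_graph R) f g"
  obtains s t where "is_cycle (annihilator_graph R) [f, g, s, t]"
proof -
  have R: "f \<in> R" "g \<in> R" "f \<noteq> 0" "g \<noteq> 0"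
    using fg by (auto simp: adj_iff nonzero_zero_divisors_def)
  obtain s t where st: "s \<in> R" "t \<in> R" "s * g = 0" "t * f = 0" "s * f \<noteq> 0" "t * g \<noteq> 0" "s * t = 0"
    by (rule orthogonal_witnesses[OF fg])
  have "s \<noteq> 0" "t \<noteq> 0"
    using st by auto
  obtain s' where s': "s' \<in> R" "s' \<noteq> f" "s' \<noteq> 0" "\<And>b. b \<in> R \<Longrightarrow> s' * b = 0 \<longleftrightarrow> s * b = 0"
    using associate_avoiding[OF \<open>s \<in> R\<close> \<open>s \<noteq> 0\<close>] by blast
  obtain t' where t': "t' \<in> R" "t' \<noteq> g" "t' \<noteq> 0" "\<And>b. b \<in> R \<Longrightarrow> t' * b = 0 \<longleftrightarrow> t * b = 0"
    using associate_avoiding[OF \<open>t \<in> R\<close> \<open>t \<noteq> 0\<close>] by blast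
  have "g * s' = 0"
    using s'(4)[of g] st(3) R by (simp add: mult.commute)
  moreover have "t' * f = 0"
    using t'(4)[of f] st(4) R by simp
  moreover have "s' * t' = 0"
    using s'(4)[of t'] t'(4)[of s] st t'(1) by (simp add: mult.commute)
  ultimately have "is_cycle (annihilator_graph R) [f, g, s', t']"
    using fg R s'(1-3) t'(1-3) by (auto simp: is_cycle_4_iff intro: adj_if_product_zero)
  then show ?thesis by (rule that)
qed

text \<open>If \<open>ann f \<subseteq> ann g\<close>, any nonzero element of \<open>ann f\<close> and its double are two common neighbours
  of \<open>f\<close> and \<open>g\<close>.\<close>

lemma square_if_not_adjacent:
  assumes f: "f \<in> nonzero_zero_divisors R" and g: "g \<in> nonzero_zero_divisors R" and "f \<noteq> g"
    and "\<not> adj (annihilator_graph R) f g"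
  obtains s t where "is_cycle (annihilator_graph R) [f, s, g, t]"
proof -
  have R: "f \<in> R" "g \<in> R" "f \<noteq> 0" "g \<noteq> 0"
    using f g by (auto simp: nonzero_zero_divisors_def)
  have "(\<forall>r\<in>R. r * f = 0 \<longrightarrow> r * g = 0) \<or> (\<forall>r\<in>R. r * g = 0 \<longrightarrow> r * f = 0)"
    using assms by (auto simp: adj_iff)
  moreover obtain u v where "u \<in> R" "u \<noteq> 0" "f * u = 0" "v \<in> R" "v \<noteq> 0" "g * v = 0"
    using f g by (auto simp: nonzero_zero_divisors_def)
  ultimately obtain s where s: "s \<in> R" "s \<noteq> 0" "s * f = 0" "s * g = 0"
    by (auto simp: mult.commute)
  obtain t where t: "t \<in> R" "t \<noteq> s" "t \<noteq> 0" "\<And>b. b \<in> R \<Longrightarrow> t * b = 0 \<longleftrightarrow> s * b = 0"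
    using associate_avoiding[OF s(1,2)] by blast
  have "t * f = 0" "t * g = 0"
    using t(4) s R by auto
  moreover have "f * s = 0" "g * t = 0"
    using calculation s by (simp_all add: mult.commute)
  ultimately have "is_cycle (annihilator_graph R) [f, s, g, t]"
    using R s t(1-3) \<open>f \<noteq> g\<close> by (auto simp: is_cycle_4_iff intro: adj_if_product_zero)
  then show ?thesis by (rule that)
qed

text \<open>With orthogonal witnesses \<open>s, t\<close>, the product \<open>fg\<close> annihilates \<open>s + t\<close> but neither \<open>f\<close> nor \<open>g\<close>,
  while \<open>t \<in> ann f\<close> and \<open>s \<in> ann g\<close> do not annihilate \<open>s + t\<close>.\<close>

lemma triangle_if_product_nonzero:
  assumes fg: "adj (annihilator_graph R) f g" and nz: "f * g \<noteq> 0"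
  obtains h where "adj (annihilator_graph R) g h" "adj (annihilator_graph R) h f"
proof -
  have R: "f \<in> R" "g \<in> R" and Z: "f \<in> nonzero_zero_divisors R" "g \<in> nonzero_zero_divisors R"
    using fg by (auto simp: adj_iff nonzero_zero_divisors_def)
  obtain s t where st: "s \<in> R" "t \<in> R" "s * g = 0" "t * f = 0" "s * f \<noteq> 0" "t * g \<noteq> 0" "s * t = 0"
    by (rule orthogonal_witnesses[OF fg])
  have "s \<noteq> 0" "t \<noteq> 0"
    using st by auto
  then have "s * s \<noteq> 0" "t * t \<noteq> 0"
    using st(1,2) square_nonzero by blast+
  then have sh: "s * (s + t) \<noteq> 0" and th: "t * (s + t) \<noteq> 0"
    using st by (simp_all add: distrib_left mult.commute)
  have "(s + t) * (f * g) = (s * g) * f + (t * f) * g"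
    by (simp add: algebra_simps)
  then have h0: "(s + t) * (f * g) = 0"
    using st by simp
  moreover have "s + t \<noteq> 0"
    using sh by auto
  ultimately have "s + t \<in> nonzero_zero_divisors R"
    using st R nz mult_closed add_closed unfolding nonzero_zero_divisors_def by blast
  moreover have "(f * g) * f \<noteq> 0" "(f * g) * g \<noteq> 0"
    using mult_square_nonzero[of f g] mult_square_nonzero[of g f] R nz by (simp_all add: mult_ac)
  moreover have "(f * g) * (s + t) = 0"
    using h0 by (simp add: mult.commute)
  moreover have "f * g \<in> R"
    using R mult_closed by blast
  ultimately show ?thesis
    using that[of "s + t"] Z st sh th adjI[of g "s + t" "f * g" s] adjI[of "s + t" f t "f * g"]
    by blast
qed

definition annihilator_splits :: "'r \<Rightarrow> bool" where
  "annihilator_splits f \<longleftrightarrow>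
     (\<exists>u \<in> annihilator R f. \<exists>v \<in> annihilator R f. u \<noteq> 0 \<and> v \<noteq> 0 \<and> u * v = 0)"

text \<open>A common annihilator of \<open>f\<close> and \<open>g\<close> is at once the third vertex. Otherwise every nonzero
  element of \<open>ann f\<close> has nonzero product with \<open>g\<close>, and conversely; with \<open>u, v\<close> splitting \<open>ann f\<close> and
  \<open>u', v'\<close> splitting \<open>ann g\<close>, the third vertex is \<open>u + u'\<close>: its annihilator contains \<open>v\<close> and \<open>v'\<close>,
  and misses \<open>u\<close> and \<open>u'\<close>.\<close>

lemma triangle_if_product_zero:
  assumes f: "f \<in> nonzero_zero_divisors R" and g: "g \<in> nonzero_zero_divisors R"
    and splits: "annihilator_splits f" "annihilator_splits g"
  obtains h where "adj (annihilator_graph R) g h" "adj (annihilator_graph R) h f"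
proof (cases "\<exists>h\<in>R. h \<noteq> 0 \<and> h * f = 0 \<and> h * g = 0")
  case True
  then obtain h where "h \<in> R" "h \<noteq> 0" "h * f = 0" "h * g = 0"
    by blast
  moreover from this have "g * h = 0"
    by (simp add: mult.commute)
  ultimately show ?thesis
    using f g by (intro that[of h] adj_if_product_zero) (simp_all add: nonzero_zero_divisors_def)
next
  case False
  then have common: "r = 0" if "r \<in> R" "r * f = 0" "r * g = 0" for r
    using that by blast
  obtain u v where uv: "u \<in> R" "v \<in> R" "u * f = 0" "v * f = 0" "u \<noteq> 0" "v \<noteq> 0" "u * v = 0"
    using splits(1) by (auto simp: annihilator_splits_def annihilator_def)
  obtain u' v' where uv': "u' \<in> R" "v' \<in> R" "u' * g = 0" "v' * g = 0" "u' \<noteq> 0" "v' \<noteq> 0" "u' * v' = 0"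
    using splits(2) by (auto simp: annihilator_splits_def annihilator_def)
  have cross: "a * b = 0" if "a \<in> R" "b \<in> R" "a * f = 0" "b * g = 0" for a b
  proof -
    have "(a * b) * f = (a * f) * b" "(a * b) * g = (b * g) * a"
      by (simp_all add: mult_ac)
    then show ?thesis
      using common that mult_closed by simp
  qed
  have "u * u \<noteq> 0" "u' * u' \<noteq> 0"
    using uv uv' square_nonzero by blast+
  moreover have "u * u' = 0" "v * u' = 0" "u * v' = 0"
    using cross uv uv' by auto
  ultimately have prods: "u * (u + u') \<noteq> 0" "u' * (u + u') \<noteq> 0" "v * (u + u') = 0" "v' * (u + u') = 0"
    using uv uv' by (simp_all add: distrib_left mult.commute)
  have "v * g \<noteq> 0" "v' * f \<noteq> 0"
    using common uv uv' by blast+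
  moreover have "u + u' \<in> nonzero_zero_divisors R"
  proof -
    have "u + u' \<noteq> 0" "(u + u') * v = 0"
      using prods by (auto simp: mult.commute)
    then show ?thesis
      using uv uv' add_closed unfolding nonzero_zero_divisors_def by blast
  qed
  ultimately show ?thesis
    using that[of "u + u'"] f g uv uv' prods adjI[of g "u + u'" v u'] adjI[of "u + u'" f u v']
    by blast
qed

text \<open>If \<open>ann f\<close> does not split, all its nonzero elements have the same annihilator. A neighbour
  \<open>h\<close> of \<open>f\<close> has nonzero product with some \<open>r \<in> ann f\<close>, so \<open>rh\<close> and \<open>g\<close> are both such elements, and
  \<open>ann h \<subseteq> ann rh = ann g\<close> prevents \<open>h\<close> from being adjacent to \<open>g\<close>.\<close>

lemma no_triangle_if_not_splits:
  assumes fg0: "f * g = 0" and unsplit: "\<not> annihilator_splits f"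
    and gh: "adj (annihilator_graph R) g h" and hf: "adj (annihilator_graph R) h f"
  shows False
proof -
  have R: "f \<in> R" "g \<in> R" "h \<in> R"
    using gh hf by (auto simp: adj_iff nonzero_zero_divisors_def)
  obtain r where r: "r \<in> R" "r * f = 0" "r * h \<noteq> 0"
    using hf unfolding adj_iff by blast
  obtain k where k: "k \<in> R" "k * h = 0" "k * g \<noteq> 0"
    using gh unfolding adj_iff by blast
  have "(r * h) * f = (r * f) * h" "(k * g) * f = (f * g) * k" "(r * h) * (k * g) = (k * h) * (r * g)"
    by (simp_all add: mult_ac)
  then have "r * h \<in> annihilator R f" "k * g \<in> annihilator R f" "(r * h) * (k * g) = 0"
    using r k R fg0 mult_closed by (simp_all add: annihilator_def)
  with r k unsplit show False
    unfolding annihilator_splits_def by blast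
qed

end


section \<open>Functions supported in an ideal of closed sets\<close>

lemma ideal_cont_ring_reduced_subring:
  assumes "ideal_of_closed_sets X P"
  shows "reduced_subring (ideal_cont_ring X P)"
proof
  fix a b :: "'a \<Rightarrow> real"
  show "a + b \<in> ideal_cont_ring X P" "a * b \<in> ideal_cont_ring X P"
    if "a \<in> ideal_cont_ring X P" "b \<in> ideal_cont_ring X P"
    using ideal_cont_ring_subring[OF assms] that by blast+
  show "a = 0" if "a * a = 0"
    using that by (simp add: fun_eq_iff)
  show "a = 0" if "a + a = 0"
    using that by (simp add: fun_eq_iff)
qed

lemma openin_cozero_set:
  assumes "f \<in> ideal_cont_ring X P"
  shows "openin X {x. f x \<noteq> 0}"
proof -
  have f: "continuous_map X euclideanreal f" "\<And>x. x \<notin> topspace X \<Longrightarrow> f x = 0"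
    using assms by (auto simp: ideal_cont_ring_def cont_ring_def)
  have "openin X {x \<in> topspace X. f x \<in> - {0}}"
    using f(1) by (rule openin_continuous_map_preimage) (simp add: open_Compl)
  moreover have "{x \<in> topspace X. f x \<in> - {0}} = {x. f x \<noteq> 0}"
    using f(2) by auto
  ultimately show ?thesis by simp
qed

lemma cozero_subset_ideal_points:
  assumes "f \<in> ideal_cont_ring X P" "f x \<noteq> 0"
  shows "x \<in> ideal_points X P"
proof -
  have "{x. f x \<noteq> 0} = topspace X - zero_set X f"
    using assms(1) by (auto simp: ideal_cont_ring_def cont_ring_def zero_set_def)
  then have "X closure_of {x. f x \<noteq> 0} \<in> P"
    using assms(1) by (simp add: ideal_cont_ring_def)
  then show ?thesis
    using openin_cozero_set[OF assms(1)] assms(2) unfolding ideal_points_def by blast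
qed

text \<open>Complete regularity gives a function supported in the intersection of the open set \<open>W\<close> with a
  neighbourhood \<open>V\<close> of \<open>x\<close> whose closure lies in \<open>P\<close>; that closure then contains the support.\<close>

lemma bump_function:
  assumes X: "tychonoff_space X" and P: "ideal_of_closed_sets X P"
    and x: "x \<in> ideal_points X P" "x \<in> W" and W: "openin X W"
  obtains b where "b \<in> ideal_cont_ring X P" "b x \<noteq> 0" "\<And>y. y \<notin> W \<Longrightarrow> b y = 0"
proof -
  obtain V where V: "openin X V" "x \<in> V" "X closure_of V \<in> P"
    using x(1) by (auto simp: ideal_points_def)
  have "openin X (V \<inter> W)"
    using V W by blast
  then have cl: "closedin X (topspace X - V \<inter> W)" and xX: "x \<in> topspace X - (topspace X - V \<inter> W)"
    using x V openin_subset by (blast, fastforce)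
  obtain h where h: "continuous_map X (top_of_set {0..1::real}) h" "h x = 0"
    "h ` (topspace X - V \<inter> W) \<subseteq> {1}"
    using X cl xX unfolding tychonoff_space_def completely_regular_space_def by blast
  define b where "b = (\<lambda>y. if y \<in> topspace X then 1 - h y else 0)"
  have out: "b y = 0" if "y \<notin> V \<inter> W" for y
    using h(3) that by (auto simp: b_def)
  have "continuous_map X euclideanreal h"
    using h(1) by (simp add: continuous_map_in_subtopology)
  then have "continuous_map X euclideanreal (\<lambda>y. 1 - h y)"
    by (intro continuous_map_diff) auto
  then have "continuous_map X euclideanreal b"
    by (rule continuous_map_eq) (simp add: b_def)
  moreover have "topspace X - zero_set X b \<subseteq> V"
    using out by (auto simp: zero_set_def)
  then have "X closure_of (topspace X - zero_set X b) \<in> P"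
    using P V(3) closure_of_mono[of _ V X] closedin_closure_of
    unfolding ideal_of_closed_sets_def by metis
  ultimately have "b \<in> ideal_cont_ring X P"
    by (simp add: ideal_cont_ring_def cont_ring_def b_def)
  moreover have "b x \<noteq> 0"
    using h(2) xX by (simp add: b_def)
  ultimately show ?thesis
    using that out by blast
qed

lemma two_le_card_iff:
  "card_at_least S 2 \<longleftrightarrow> (\<exists>x\<in>S. \<exists>y\<in>S. x \<noteq> y)"
proof
  assume "card_at_least S 2"
  then obtain T where "T \<subseteq> S" "card T = 2"
    unfolding card_at_least_def
    by (metis infinite_arbitrarily_large obtain_subset_with_card_n)
  then show "\<exists>x\<in>S. \<exists>y\<in>S. x \<noteq> y"
    by (auto simp: card_2_iff)
next
  assume "\<exists>x\<in>S. \<exists>y\<in>S. x \<noteq> y"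
  then obtain x y where "{x, y} \<subseteq> S" "x \<noteq> y"
    by blast
  then show "card_at_least S 2"
    unfolding card_at_least_def using card_mono[of S "{x, y}"] by auto
qed

text \<open>Members of \<open>ann f\<close> live on \<open>int Z(f) \<inter> X\<^sub>P\<close>. Two with product \<open>0\<close> are nonzero at different
  points of it; conversely two points of it are separated by disjoint open sets, which carry
  orthogonal bump functions.\<close>

lemma annihilator_splits_iff:
  assumes X: "tychonoff_space X" and P: "ideal_of_closed_sets X P"
    and f: "f \<in> ideal_cont_ring X P"
  shows "reduced_subring.annihilator_splits (ideal_cont_ring X P) f \<longleftrightarrow>
           card_at_least (X interior_of zero_set X f \<inter> ideal_points X P) 2"
    (is "?S \<longleftrightarrow> card_at_least ?D 2")
proof -
  interpret reduced_subring "ideal_cont_ring X P"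
    using P by (rule ideal_cont_ring_reduced_subring)
  show ?thesis
  proof
    assume ?S
    then obtain u v where uv: "u \<in> ideal_cont_ring X P" "v \<in> ideal_cont_ring X P"
      "u * f = 0" "v * f = 0" "u \<noteq> 0" "v \<noteq> 0" "u * v = 0"
      by (auto simp: annihilator_splits_def annihilator_def)
    have D: "x \<in> ?D" if w: "w \<in> ideal_cont_ring X P" "w * f = 0" "w x \<noteq> 0" for w x
    proof -
      have "{y. w y \<noteq> 0} \<subseteq> zero_set X f"
        using w(2) openin_subset[OF openin_cozero_set[OF w(1)]]
        by (auto simp: zero_set_def fun_eq_iff)
      then have "x \<in> X interior_of zero_set X f"
        using openin_cozero_set[OF w(1)] w(3) by (auto simp: interior_of_def)
      then show ?thesis
        using cozero_subset_ideal_points[OF w(1,3)] by blast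
    qed
    obtain x y where "u x \<noteq> 0" "v y \<noteq> 0"
      using uv by (auto simp: fun_eq_iff)
    moreover from this have "x \<noteq> y"
      using uv(7) by (auto simp: fun_eq_iff)
    ultimately show "card_at_least ?D 2"
      unfolding two_le_card_iff using D uv by blast
  next
    assume "card_at_least ?D 2"
    then obtain x y where xy: "x \<in> ?D" "y \<in> ?D" "x \<noteq> y"
      by (auto simp: two_le_card_iff)
    let ?I = "X interior_of zero_set X f"
    have "x \<in> topspace X" "y \<in> topspace X"
      using xy(1,2) interior_of_subset_topspace[of X "zero_set X f"] by auto
    then obtain U V where UV: "openin X U" "openin X V" "x \<in> U" "y \<in> V" "disjnt U V"
      using X xy(3) unfolding tychonoff_space_def Hausdorff_space_def by blast
    obtain u where u: "u \<in> ideal_cont_ring X P" "u x \<noteq> 0" "\<And>z. z \<notin> U \<inter> ?I \<Longrightarrow> u z = 0"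
      using bump_function[OF X P, of x "U \<inter> ?I"] UV xy openin_interior_of by blast
    obtain v where v: "v \<in> ideal_cont_ring X P" "v y \<noteq> 0" "\<And>z. z \<notin> V \<inter> ?I \<Longrightarrow> v z = 0"
      using bump_function[OF X P, of y "V \<inter> ?I"] UV xy openin_interior_of by blast
    have I: "f z = 0" if "z \<in> ?I" for z
      using that interior_of_subset[of X "zero_set X f"] by (auto simp: zero_set_def)
    have "u * f = 0" "v * f = 0" "u * v = 0"
      using u(3) v(3) I UV(5) by (force simp: fun_eq_iff disjnt_iff)+
    moreover have "u \<noteq> 0" "v \<noteq> 0"
      using u v by auto
    ultimately show ?S
      using u v unfolding annihilator_splits_def annihilator_def by blast
  qed
qed

lemma three_orthogonal_functions:
  assumes X: "tychonoff_space X" and P: "ideal_of_closed_sets X P"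
    and three: "card_at_least (ideal_points X P) 3"
  obtains a b c where "{a, b, c} \<subseteq> ideal_cont_ring X P" "a \<noteq> 0" "b \<noteq> 0" "c \<noteq> 0"
    "a * b = 0" "b * c = 0" "c * a = 0"
proof -
  obtain T where "T \<subseteq> ideal_points X P" "card T = 3"
    using three unfolding card_at_least_def
    by (metis infinite_arbitrarily_large obtain_subset_with_card_n)
  then obtain x y z where xyz: "x \<in> ideal_points X P" "y \<in> ideal_points X P" "z \<in> ideal_points X P"
    "x \<noteq> y" "y \<noteq> z" "z \<noteq> x"
    by (auto simp: card_3_iff)
  have sep: "\<exists>U V. openin X U \<and> openin X V \<and> p \<in> U \<and> q \<in> V \<and> disjnt U V"
    if "p \<in> ideal_points X P" "q \<in> ideal_points X P" "p \<noteq> q" for p q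
  proof -
    have "p \<in> topspace X" "q \<in> topspace X"
      using that openin_subset by (fastforce simp: ideal_points_def)+
    then show ?thesis
      using X that(3) unfolding tychonoff_space_def Hausdorff_space_def by blast
  qed
  obtain U1 V1 where 1: "openin X U1" "openin X V1" "x \<in> U1" "y \<in> V1" "disjnt U1 V1"
    using sep[OF xyz(1,2,4)] by blast
  obtain U2 V2 where 2: "openin X U2" "openin X V2" "y \<in> U2" "z \<in> V2" "disjnt U2 V2"
    using sep[OF xyz(2,3,5)] by blast
  obtain U3 V3 where 3: "openin X U3" "openin X V3" "z \<in> U3" "x \<in> V3" "disjnt U3 V3"
    using sep[OF xyz(3,1,6)] by blast
  obtain a where a: "a \<in> ideal_cont_ring X P" "a x \<noteq> 0" "\<And>w. w \<notin> U1 \<inter> V3 \<Longrightarrow> a w = 0"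
    using bump_function[OF X P, of x "U1 \<inter> V3"] 1 3 xyz by blast
  obtain b where b: "b \<in> ideal_cont_ring X P" "b y \<noteq> 0" "\<And>w. w \<notin> U2 \<inter> V1 \<Longrightarrow> b w = 0"
    using bump_function[OF X P, of y "U2 \<inter> V1"] 1 2 xyz by blast
  obtain c where c: "c \<in> ideal_cont_ring X P" "c z \<noteq> 0" "\<And>w. w \<notin> U3 \<inter> V2 \<Longrightarrow> c w = 0"
    using bump_function[OF X P, of z "U3 \<inter> V2"] 2 3 xyz by blast
  have "a w * b w = 0" "b w * c w = 0" "c w * a w = 0" for w
    using a(3)[of w] b(3)[of w] c(3)[of w] 1(5) 2(5) 3(5) by (auto simp: disjnt_iff)
  then have "a * b = 0" "b * c = 0" "c * a = 0"
    by (simp_all add: fun_eq_iff)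
  moreover have "a \<noteq> 0" "b \<noteq> 0" "c \<noteq> 0"
    using a b c by auto
  ultimately show ?thesis
    using that a b c by blast
qed


section \<open>Cycle lengths and girth\<close>

theorem theorem3p14:
  fixes X :: "'a topology" and P :: "'a set set"
  assumes "tychonoff_space X"
    and "ideal_of_closed_sets X P"
    and "card_at_least (ideal_points X P) 3"
  shows
    "(\<forall>f g. adj (annihilator_graph (ideal_cont_ring X P)) f g \<longrightarrow>
        (\<exists>p. is_cycle (annihilator_graph (ideal_cont_ring X P)) p \<and> length p = 4 \<and>
             {f, g} \<in> cycle_edges p) \<and>
        3 \<le> min_cycle_length (annihilator_graph (ideal_cont_ring X P)) f g \<and>
        min_cycle_length (annihilator_graph (ideal_cont_ring X P)) f g \<le> 4) \<and>
     (\<forall>f \<in> nonzero_zero_divisors (ideal_cont_ring X P).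
      \<forall>g \<in> nonzero_zero_divisors (ideal_cont_ring X P). f \<noteq> g \<longrightarrow>
        (adj (annihilator_graph (ideal_cont_ring X P)) f g \<and> f * g \<noteq> 0 \<longrightarrow>
           min_cycle_length (annihilator_graph (ideal_cont_ring X P)) f g = 3) \<and>
        (adj (annihilator_graph (ideal_cont_ring X P)) f g \<and> f * g = 0 \<longrightarrow>
           (card_at_least (X interior_of zero_set X f \<inter> ideal_points X P) 2 \<and>
            card_at_least (X interior_of zero_set X g \<inter> ideal_points X P) 2 \<longrightarrow>
              min_cycle_length (annihilator_graph (ideal_cont_ring X P)) f g = 3) \<and>
           (card (X interior_of zero_set X f \<inter> ideal_points X P) = 1 \<or>
            card (X interior_of zero_set X g \<inter> ideal_points X P) = 1 \<longrightarrow>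
              min_cycle_length (annihilator_graph (ideal_cont_ring X P)) f g = 4)) \<and>
        (\<not> adj (annihilator_graph (ideal_cont_ring X P)) f g \<longrightarrow>
           min_cycle_length (annihilator_graph (ideal_cont_ring X P)) f g = 4)) \<and>
     girth (annihilator_graph (ideal_cont_ring X P)) = 3"
proof -
  let ?R = "ideal_cont_ring X P"
  let ?G = "annihilator_graph ?R"
  interpret reduced_subring ?R
    using assms(2) by (rule ideal_cont_ring_reduced_subring)

  have square: "\<exists>p. is_cycle ?G p \<and> length p = 4 \<and> {f, g} \<in> cycle_edges p"
    and edge_le_4: "min_cycle_length ?G f g \<le> 4" if fg: "adj ?G f g" for f g
  proof -
    obtain s t where sq: "is_cycle ?G [f, g, s, t]"
      using square_through_edge[OF fg] by blast
    moreover have "{f, g} \<in> cycle_edges [f, g, s, t]"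
      unfolding cycle_edges_def by (auto intro!: exI[of _ 0])
    ultimately show "\<exists>p. is_cycle ?G p \<and> length p = 4 \<and> {f, g} \<in> cycle_edges p"
      by (intro exI[of _ "[f, g, s, t]"]) simp
    show "min_cycle_length ?G f g \<le> 4"
      using min_cycle_length_le_4[OF sq] by simp
  qed

  have product_nonzero: "min_cycle_length ?G f g = 3" if "adj ?G f g" "f * g \<noteq> 0" for f g
    using triangle_if_product_nonzero[OF that] min_cycle_length_eq_3 that(1) by metis

  have splitting: "min_cycle_length ?G f g = 3"
    if fg: "adj ?G f g" and "card_at_least (X interior_of zero_set X f \<inter> ideal_points X P) 2"
      "card_at_least (X interior_of zero_set X g \<inter> ideal_points X P) 2" for f g
  proof -
    have Z: "f \<in> nonzero_zero_divisors ?R" "g \<in> nonzero_zero_divisors ?R"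
      using fg by (simp_all add: adj_iff)
    then have "f \<in> ?R" "g \<in> ?R"
      by (simp_all add: nonzero_zero_divisors_def)
    then have "annihilator_splits f" "annihilator_splits g"
      using annihilator_splits_iff[OF assms(1,2)] that by simp_all
    then obtain h where "adj ?G g h" "adj ?G h f"
      using triangle_if_product_zero[OF Z] by blast
    with fg show ?thesis
      by (rule min_cycle_length_eq_3)
  qed

  have singleton: "min_cycle_length ?G f g = 4"
    if fg: "adj ?G f g" "f * g = 0"
      and card1: "card (X interior_of zero_set X f \<inter> ideal_points X P) = 1 \<or>
                  card (X interior_of zero_set X g \<inter> ideal_points X P) = 1" for f g
  proof (rule antisym)
    have R: "f \<in> ?R" "g \<in> ?R"
      using fg by (auto simp: adj_iff nonzero_zero_divisors_def)
    have small: "\<not> card_at_least S 2" if "card S = 1" for S :: "'a set"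
      using that card.infinite[of S] by (auto simp: card_at_least_def)
    have unsplit: "\<not> annihilator_splits f \<or> \<not> annihilator_splits g"
      using card1 small annihilator_splits_iff[OF assms(1,2)] R by blast
    have gf: "g * f = 0"
      using fg(2) by (simp add: mult.commute)
    have "\<not> (adj ?G f g \<and> adj ?G g h \<and> adj ?G h f)" for h
      using unsplit no_triangle_if_not_splits[OF fg(2), of h] no_triangle_if_not_splits[OF gf, of h]
        adj_annihilator_graph_sym by blast
    then show "4 \<le> min_cycle_length ?G f g"
      using adj_annihilator_graphD(1)[OF fg(1)] by (intro min_cycle_length_ge_4)
    show "min_cycle_length ?G f g \<le> 4"
      using fg(1) by (rule edge_le_4)
  qed

  have non_adjacent: "min_cycle_length ?G f g = 4"
    if fg: "f \<in> nonzero_zero_divisors ?R" "g \<in> nonzero_zero_divisors ?R" "f \<noteq> g"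
      "\<not> adj ?G f g" for f g
  proof (rule antisym)
    show "4 \<le> min_cycle_length ?G f g"
      using fg by (intro min_cycle_length_ge_4) auto
    obtain s t where "is_cycle ?G [f, s, g, t]"
      using square_if_not_adjacent[OF fg] by blast
    then show "min_cycle_length ?G f g \<le> 4"
      by (rule min_cycle_length_le_4) auto
  qed

  have girth: "girth ?G = 3"
  proof (rule antisym)
    obtain a b c where abc: "{a, b, c} \<subseteq> ?R" "a \<noteq> 0" "b \<noteq> 0" "c \<noteq> 0"
      "a * b = 0" "b * c = 0" "c * a = 0"
      using three_orthogonal_functions[OF assms] by blast
    then have "is_cycle ?G [a, b, c]"
      unfolding is_cycle_3_iff by (intro conjI adj_if_product_zero) auto
    then have "girth ?G \<le> enat (length [a, b, c])"
      unfolding girth_def by (intro Inf_lower) blast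
    then show "girth ?G \<le> 3"
      by (simp add: numeral_eq_enat eval_nat_numeral)
  qed (rule girth_ge_3)

  show ?thesis
    by (intro conjI allI ballI impI; (elim conjE)?;
        (rule square edge_le_4 min_cycle_length_ge_3 product_nonzero splitting singleton
          non_adjacent girth; assumption))
qed

end
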